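(* Let $X=(X_1,\dots,X_p)$ be a random vector, let $Y=f(X)$ be square-integrable with $\mathrm{Var}(Y)\neq 0$, and let $\mathcal{C}=\{C_1,\dots,C_k\}$ be a partition of $[1:p]$ such that the groups of random variables $A_1=X_{C_1},\dots,A_k=X_{C_k}$ are independent. Suppose the model is block-additive, i.e. $Y=\sum_{j=1}^kg_j(A_j)$ for some functions $g_1,\dots,g_k$. For $i\in[1:p]$ let $j(i)\in[1:k]$ be the index such that $i\in C_{j(i)}$. Then for all $i\in[1:p]$, the Shapley effect $\eta_i$ of $X_i$ for the output $Y$ satisfies $$\eta_i=S^g_{j(i)}\,\eta_i^{g,j(i)},$$ where $S_j^g=\mathrm{Var}(g_j(A_j))/\mathrm{Var}(Y)$ and $\eta_i^{g,j(i)}$ is the Shapley effect of $X_i$ for the output $g_{j(i)}(A_{j(i)})$ as a function of the inputs $X_{C_{j(i)}}$.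
   Context: Let $(\Omega,\mathcal{A},\mathbb{P})$ be a probability space, let $E=\times_{i=1}^pE_i$ be a product of measurable spaces $(E_i,\mathcal{E}_i)$ with the product $\sigma$-algebra $\mathcal{E}=\otimes_{i=1}^p\mathcal{E}_i$, and let $X=(X_1,\dots,X_p):\Omega\to E$ be a random variable. Let $f:(E,\mathcal{E})\to(\mathbb{R},\mathcal{B}(\mathbb{R}))$ be measurable with $f(X)\in L^2$; $Y:=f(X)$, and $\mathrm{Var}(Y)\neq0$ is assumed. $[1:p]$ is the set of integers from $1$ to $p$, $-i:=[1:p]\setminus\{i\}$, and $|u|$ is the cardinality of $u$. For $u\subseteq[1:p]$, $x_u:=(x_i)_{i\in u}$; conditioning on $X_\emptyset$ is trivial conditioning, i.e. $\mathrm{E}(\cdot\mid X_\emptyset)=\mathrm{E}(\cdot)$. Put $V_u:=\mathrm{Var}(\mathrm{E}(Y\mid X_u))$. The Shapley effects of $Y$ are $$\eta_i:=\frac{1}{p\,\mathrm{Var}(Y)}\sum_{u\subseteq -i}\binom{p-1}{|u|}^{-1}\left(V_{u\cup\{i\}}-V_u\right),\qquad i\in[1:p].$$ The (nonempty, disjoint) sets $C_1,\dots,C_k$ partition $[1:p]$, and $A_j:=X_{C_j}$. The functions $g_j$ are real-valued, measurable, with $g_j(A_j)\in L^2$. For $j\in[1:k]$ and $u\subseteq C_j$ put $V_u^{g,j}:=\mathrm{Var}(\mathrm{E}(g_j(A_j)\mid X_u))$, and for $i\in C_j$, $$\eta_i^{g,j}:=\frac{1}{|C_j|\,\mathrm{Var}(g_j(A_j))}\sum_{u\subseteq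 C_j\setminus\{i\}}\binom{|C_j|-1}{|u|}^{-1}\left(V_{u\cup\{i\}}^{g,j}-V_u^{g,j}\right).$$ Convention: when $\mathrm{Var}(g_j(A_j))=0$ (so that $S_j^g=0$ and $\eta_i^{g,j}$ is not defined), the product $S_j^g\eta_i^{g,j}$ is taken to be $0$. *)

theory Defs
  imports "HOL-Probability.Probability"
begin

(* A point of the product space is an extensional function on the index set, so
   restrict (X \<omega>) u is the subvector X_u; its values lie in the product of the E i, i \<in> u. *)
definition sigma_of_inputs ::
  "'a measure \<Rightarrow> (nat \<Rightarrow> 'b measure) \<Rightarrow> ('a \<Rightarrow> nat \<Rightarrow> 'b) \<Rightarrow> nat set \<Rightarrow> 'a measure" where
  "sigma_of_inputs M E X u =
     vimage_algebra (space M) (\<lambda>\<omega>. restrict (X \<omega>) u) (PiM u E)"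

(* Var (E (Z | X_u)).  For u = {} the product space is a single point, the generated
   sigma-algebra is trivial, and the conditional expectation is the constant E(Z). *)
definition explained_variance ::
  "'a measure \<Rightarrow> (nat \<Rightarrow> 'b measure) \<Rightarrow> ('a \<Rightarrow> nat \<Rightarrow> 'b) \<Rightarrow> ('a \<Rightarrow> real) \<Rightarrow> nat set \<Rightarrow> real" where
  "explained_variance M E X Z u =
     prob_space.variance M (real_cond_exp M (sigma_of_inputs M E X u) Z)"

(* Shapley effect of X_i (i \<in> D) for the output Z, where the inputs are the X_l with l \<in> D.
   If Z has variance 0, division by zero makes the value 0. *)
definition shapley_effect ::
  "'a measure \<Rightarrow> (nat \<Rightarrow> 'b measure) \<Rightarrow> ('a \<Rightarrow> nat \<Rightarrow> 'b) \<Rightarrow> nat set \<Rightarrow> ('a \<Rightarrow> real) \<Rightarrow> nat \<Rightarrow> real" where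
  "shapley_effect M E X D Z i =
     1 / (real (card D) * prob_space.variance M Z) *
     (\<Sum>u\<in>Pow (D - {i}).
        inverse (real ((card D - 1) choose card u)) *
        (explained_variance M E X Z (u \<union> {i}) - explained_variance M E X Z u))"

end

theory Submission
  imports Defs
begin

text \<open>
  Fix an input \<open>i\<close>, let \<open>C\<close> be its block and \<open>D\<close> the union of the other blocks, and write
  \<open>Y = U + W\<close> with \<open>U = g(X\<^sub>C)\<close> and \<open>W\<close> the sum of the other summands, a function of
  \<open>X\<^sub>D\<close>. As the blocks are independent, so are \<open>X\<^sub>C\<close> and \<open>X\<^sub>D\<close>.

  For \<open>a \<subseteq> C\<close> and \<open>b \<subseteq> D\<close>, the information in \<open>X\<^sub>b\<close> says nothing about \<open>U\<close> beyond what
  \<open>X\<^sub>a\<close> says, and symmetrically for \<open>W\<close> (\<open>real_cond_exp_ignores_independent\<close>). Hence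
  \<open>E(Y | X\<^sub>a, X\<^sub>b) = E(U | X\<^sub>a) + E(W | X\<^sub>b)\<close>, a sum of independent variables, and the explained
  variances add (\<open>explained_variance_add_indep\<close>). Adding \<open>i \<in> C\<close> to \<open>a \<union> b\<close> leaves the second
  term unchanged, so the increment that \<open>i\<close> contributes depends on \<open>a\<close> and \<open>U\<close> alone.

  It remains to add up, for each \<open>a\<close>, the Shapley weights of all the sets \<open>a \<union> b\<close>. The weight of a
  set is the probability that it is exactly the set of predecessors of \<open>i\<close> in a uniformly random
  ordering of all inputs. A random ordering of \<open>C \<union> D\<close> induces a random ordering of \<open>C\<close>, so this
  total is the Shapley weight of \<open>a\<close> within \<open>C\<close> (\<open>sum_shapley_weight_Pow\<close>). The normalising
  variances then give the factor \<open>Var U / Var Y\<close>. If \<open>Var U = 0\<close> the effect for the output \<open>U\<close> is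
  zero by convention; then \<open>U\<close> explains nothing, so the effect for \<open>Y\<close> is zero as well.
\<close>

section \<open>Conditioning on two independent sources of information\<close>

context prob_space
begin

lemma indep_var_borel_of_indep_subalgebras:
  fixes U W :: "'a \<Rightarrow> real"
  assumes F: "subalgebra M F" and G: "subalgebra M G"
    and indep: "indep_set (sets F) (sets G)"
    and U: "U \<in> borel_measurable F" and W: "W \<in> borel_measurable G"
  shows "indep_var borel U borel W"
proof -
  have sp: "space F = space M" "space G = space M"
    using F G by (auto simp: subalgebra_def)
  have "sigma_sets (space M) {U -` A \<inter> space M |A. A \<in> sets borel} \<subseteq> sets F"
    unfolding sp(1)[symmetric] by (rule sets.sigma_sets_subset) (use measurable_sets[OF U] in auto)
  moreover have "sigma_sets (space M) {W -` A \<inter> space M |A. A \<in> sets borel} \<subseteq> sets G"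
    unfolding sp(2)[symmetric] by (rule sets.sigma_sets_subset) (use measurable_sets[OF W] in auto)
  ultimately have "indep_set (sigma_sets (space M) {U -` A \<inter> space M |A. A \<in> sets borel})
      (sigma_sets (space M) {W -` A \<inter> space M |A. A \<in> sets borel})"
    using indep unfolding indep_sets2_eq by blast
  then show ?thesis
    unfolding indep_var_eq
    using measurable_from_subalg[OF F U] measurable_from_subalg[OF G W] by auto
qed

text \<open>
  On a set \<open>a \<inter> b\<close> with \<open>a\<close> in \<open>F0\<close> and \<open>b\<close> in \<open>G0\<close>, independence pulls the factor
  \<open>P(b)\<close> out of the integrals of \<open>Z\<close> and of \<open>E(Z | F0)\<close>, both being \<open>F\<close>-measurable, and the
  remaining integrals over \<open>a\<close> agree by the definition of \<open>E(Z | F0)\<close>. These sets are stable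
  under intersection and generate \<open>H\<close>, so the integrals agree on all of \<open>H\<close>.
\<close>
lemma real_cond_exp_ignores_independent:
  assumes F: "subalgebra M F" and G: "subalgebra M G"
    and indep: "indep_set (sets F) (sets G)"
    and F0: "subalgebra F F0" and G0: "subalgebra G G0"
    and H: "subalgebra M H"
    and sets_H: "sets H = sigma_sets (space M) {a \<inter> b |a b. a \<in> sets F0 \<and> b \<in> sets G0}"
    and F0H: "subalgebra H F0"
    and Z: "Z \<in> borel_measurable F" and int_Z: "integrable M Z"
  shows "AE x in M. real_cond_exp M H Z x = real_cond_exp M F0 Z x"
proof -
  have F0M: "subalgebra M F0"
    using F F0 by (auto simp: subalgebra_def)
  interpret F0: finite_measure_subalgebra M F0 by unfold_locales (fact F0M)
  interpret H: finite_measure_subalgebra M H by unfold_locales (fact H)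
  let ?K = "real_cond_exp M F0 Z"
  have int_K: "integrable M ?K" by (rule F0.real_cond_exp_int[OF int_Z])
  have K_F0: "?K \<in> borel_measurable F0" by simp
  have K_F: "?K \<in> borel_measurable F" by (rule measurable_from_subalg[OF F0 K_F0])
  have space_eq: "space F = space M" "space F0 = space M" "space G0 = space M" "space H = space M"
    using F G F0 G0 H by (auto simp: subalgebra_def)
  have F0_sub: "sets F0 \<subseteq> sets F" and G0_sub: "sets G0 \<subseteq> sets G" and H_sub: "sets H \<subseteq> sets M"
    and F_sub: "sets F \<subseteq> sets M" and G_sub: "sets G \<subseteq> sets M"
    using F0 G0 H F G by (auto simp: subalgebra_def)
  let ?P = "{a \<inter> b |a b. a \<in> sets F0 \<and> b \<in> sets G0}"
  have stable: "Int_stable ?P"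
  proof (rule Int_stableI)
    fix s t assume "s \<in> ?P" "t \<in> ?P"
    then obtain a b a' b' where *: "s = a \<inter> b" "t = a' \<inter> b'" "a \<in> sets F0" "a' \<in> sets F0"
      "b \<in> sets G0" "b' \<in> sets G0" by blast
    then have "s \<inter> t = (a \<inter> a') \<inter> (b \<inter> b')" "a \<inter> a' \<in> sets F0" "b \<inter> b' \<in> sets G0" by auto
    then show "s \<inter> t \<in> ?P" by blast
  qed
  have P_space: "?P \<subseteq> Pow (space M)"
    using sets.sets_into_space[of _ F0] space_eq by auto
  (* Needed twice: for Z itself and for its conditional expectation on F0. *)
  have split: "(\<integral>x\<in>a \<inter> b. T x \<partial>M) = (\<integral>x\<in>a. T x \<partial>M) * prob b"
    if T: "integrable M T" "T \<in> borel_measurable F" and a: "a \<in> sets F" and b: "b \<in> sets G" for T a b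
  proof -
    have aM: "a \<in> sets M" and bM: "b \<in> sets M" using a b F_sub G_sub by auto
    have m1: "(\<lambda>x. indicator a x * T x :: real) \<in> borel_measurable F" using T(2) a by simp
    have m2: "(indicator b :: 'a \<Rightarrow> real) \<in> borel_measurable G" using b by simp
    have i1: "integrable M (\<lambda>x. indicator a x * T x)"
      using integrable_mult_indicator[OF aM T(1)] by simp
    have i2: "integrable M (indicator b :: 'a \<Rightarrow> real)"
      using bM by (simp add: integrable_indicator_iff emeasure_eq_measure)
    have "(\<integral>x. (indicator a x * T x) * indicator b x \<partial>M) =
        (\<integral>x. indicator a x * T x \<partial>M) * (\<integral>x. indicator b x \<partial>M)"
      by (rule indep_var_lebesgue_integral[OF indep_var_borel_of_indep_subalgebras[OF F G indep m1 m2] i1 i2])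
    moreover have "(\<integral>x. indicator b x \<partial>M) = prob b"
      using bM by simp
    ultimately show ?thesis
      by (simp add: set_lebesgue_integral_def indicator_inter_arith mult_ac)
  qed
  have integrals: "(\<integral>x\<in>s. Z x \<partial>M) = (\<integral>x\<in>s. ?K x \<partial>M)" if "s \<in> sets H" for s
  proof -
    have "s \<in> sigma_sets (space M) ?P" using that sets_H by simp
    with stable P_space show ?thesis
    proof (induct rule: sigma_sets_induct_disjoint)
      case (basic s)
      then obtain a b where s: "s = a \<inter> b" "a \<in> sets F0" "b \<in> sets G0" by blast
      have "(\<integral>x\<in>s. Z x \<partial>M) = (\<integral>x\<in>a. Z x \<partial>M) * prob b"
        unfolding s(1) by (rule split) (use int_Z Z s F0_sub G0_sub in auto)
      also have "\<dots> = (\<integral>x\<in>a. ?K x \<partial>M) * prob b"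
        using F0.real_cond_exp_intA[OF int_Z s(2)] by simp
      also have "\<dots> = (\<integral>x\<in>s. ?K x \<partial>M)"
        unfolding s(1) by (rule split[symmetric]) (use int_K K_F s F0_sub G0_sub in auto)
      finally show ?case .
    next
      case empty
      show ?case by (simp add: set_lebesgue_integral_def)
    next
      case (compl s)
      then have s: "s \<in> sets M" using sets_H H_sub by auto
      have c: "(\<integral>x\<in>space M - s. T x \<partial>M) = expectation T - (\<integral>x\<in>s. T x \<partial>M)"
        if "integrable M T" for T :: "'a \<Rightarrow> real"
      proof -
        have "(\<integral>x\<in>space M - s. T x \<partial>M) = (\<integral>x. T x - indicator s x * T x \<partial>M)"
          unfolding set_lebesgue_integral_def
          by (rule Bochner_Integration.integral_cong) (auto simp: indicator_def)
        also have "\<dots> = expectation T - (\<integral>x\<in>s. T x \<partial>M)"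
          using that integrable_mult_indicator[OF s that]
          by (simp add: set_lebesgue_integral_def)
        finally show ?thesis .
      qed
      show ?case
        using compl(2) F0.real_cond_exp_int(2)[OF int_Z] by (simp add: c int_Z int_K)
    next
      case (union A)
      have A: "A n \<in> sets M" for n using union(2) sets_H H_sub by auto
      have "(\<integral>x\<in>(\<Union>n. A n). T x \<partial>M) = (\<Sum>n. \<integral>x\<in>A n. T x \<partial>M)"
        if "integrable M T" for T :: "'a \<Rightarrow> real"
      proof (rule lebesgue_integral_countable_add)
        show "set_integrable M (\<Union>n. A n) T"
          unfolding set_integrable_def using A that by (intro integrable_mult_indicator) auto
        show "A i \<inter> A j = {}" if "i \<noteq> j" for i j
          using union(1) that by (auto simp: disjoint_family_on_def)
      qed (use A in auto)
      then show ?case using union(3) int_Z int_K by simp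
    qed
  qed
  show ?thesis
    by (rule H.real_cond_exp_charact[OF integrals int_Z int_K measurable_from_subalg[OF F0H K_F0]])
qed

lemma variance_cong_AE:
  fixes U W :: "'a \<Rightarrow> real"
  assumes "AE x in M. U x = W x" and [measurable]: "U \<in> borel_measurable M" "W \<in> borel_measurable M"
  shows "variance U = variance W"
proof -
  have "expectation U = expectation W"
    by (rule integral_cong_AE) (use assms in auto)
  then show ?thesis
    by (intro integral_cong_AE) (use assms in auto)
qed

lemma variance_add_indep:
  fixes U W :: "'a \<Rightarrow> real"
  assumes indep: "indep_var borel U borel W"
    and U: "integrable M U" "integrable M (\<lambda>x. (U x)\<^sup>2)"
    and W: "integrable M W" "integrable M (\<lambda>x. (W x)\<^sup>2)"
  shows "variance (\<lambda>x. U x + W x) = variance U + variance W"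
proof -
  have UW: "integrable M (\<lambda>x. U x * W x)"
    and eUW: "expectation (\<lambda>x. U x * W x) = expectation U * expectation W"
    using indep_var_integrable[OF indep U(1) W(1)] indep_var_lebesgue_integral[OF indep U(1) W(1)]
    by auto
  have sq: "(\<lambda>x. (U x + W x)\<^sup>2) = (\<lambda>x. (U x)\<^sup>2 + 2 * (U x * W x) + (W x)\<^sup>2)"
    by (auto simp: power2_sum fun_eq_iff)
  have int: "integrable M (\<lambda>x. (U x + W x)\<^sup>2)"
    unfolding sq using U W UW by auto
  have e: "expectation (\<lambda>x. (U x + W x)\<^sup>2) =
      expectation (\<lambda>x. (U x)\<^sup>2) + 2 * (expectation U * expectation W) + expectation (\<lambda>x. (W x)\<^sup>2)"
    unfolding sq using U W UW eUW by simp
  have i: "integrable M (\<lambda>x. U x + W x)" using U W by simp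
  show ?thesis
    unfolding variance_eq[OF i int] variance_eq[OF U] variance_eq[OF W] e
    using U W by (simp add: power2_sum)
qed

text \<open>Conditional Jensen for the square.\<close>
lemma integrable_square_real_cond_exp:
  assumes F: "subalgebra M F" and Z: "integrable M Z" "integrable M (\<lambda>x. (Z x)\<^sup>2)"
  shows "integrable M (\<lambda>x. (real_cond_exp M F Z x)\<^sup>2)"
proof -
  interpret finite_measure_subalgebra M F by unfold_locales (fact F)
  show ?thesis
    by (rule integrable_convex_cond_exp[where I = UNIV and q = "\<lambda>x. x\<^sup>2"])
      (use Z convex_power2 in auto)
qed

text \<open>
  Each summand may be conditioned on its own side only, and the two resulting conditional
  expectations inherit the independence of \<open>F\<close> and \<open>G\<close>, so no covariance term appears.
\<close>
lemma variance_real_cond_exp_add_indep: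
  assumes F: "subalgebra M F" and G: "subalgebra M G"
    and indep: "indep_set (sets F) (sets G)"
    and F0: "subalgebra F F0" and G0: "subalgebra G G0"
    and H: "subalgebra M H"
    and sets_H: "sets H = sigma_sets (space M) {a \<inter> b |a b. a \<in> sets F0 \<and> b \<in> sets G0}"
    and F0H: "subalgebra H F0" and G0H: "subalgebra H G0"
    and U: "U \<in> borel_measurable F" "integrable M U" "integrable M (\<lambda>x. (U x)\<^sup>2)"
    and W: "W \<in> borel_measurable G" "integrable M W" "integrable M (\<lambda>x. (W x)\<^sup>2)"
  shows "variance (real_cond_exp M H (\<lambda>x. U x + W x)) =
    variance (real_cond_exp M F0 U) + variance (real_cond_exp M G0 W)"
proof -
  have F0M: "subalgebra M F0" and G0M: "subalgebra M G0"
    using F F0 G G0 by (auto simp: subalgebra_def)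
  interpret F0: finite_measure_subalgebra M F0 by unfold_locales (fact F0M)
  interpret G0: finite_measure_subalgebra M G0 by unfold_locales (fact G0M)
  interpret H: finite_measure_subalgebra M H by unfold_locales (fact H)
  have indep': "indep_set (sets G) (sets F)"
    using indep unfolding indep_sets2_eq by (metis Int_commute mult.commute)
  have sets_H': "sets H = sigma_sets (space M) {a \<inter> b |a b. a \<in> sets G0 \<and> b \<in> sets F0}"
    unfolding sets_H by (rule arg_cong[where f = "sigma_sets (space M)"]) (blast intro: Int_commute)
  have "AE x in M. real_cond_exp M H (\<lambda>x. U x + W x) x = real_cond_exp M F0 U x + real_cond_exp M G0 W x"
    using H.real_cond_exp_add[OF U(2) W(2)]
      real_cond_exp_ignores_independent[OF F G indep F0 G0 H sets_H F0H U(1,2)]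
      real_cond_exp_ignores_independent[OF G F indep' G0 F0 H sets_H' G0H W(1,2)]
    by eventually_elim simp
  then have "variance (real_cond_exp M H (\<lambda>x. U x + W x)) =
      variance (\<lambda>x. real_cond_exp M F0 U x + real_cond_exp M G0 W x)"
    by (rule variance_cong_AE) auto
  also have "\<dots> = variance (real_cond_exp M F0 U) + variance (real_cond_exp M G0 W)"
  proof (rule variance_add_indep)
    show "indep_var borel (real_cond_exp M F0 U) borel (real_cond_exp M G0 W)"
      by (rule indep_var_borel_of_indep_subalgebras[OF F G indep])
        (auto intro: measurable_from_subalg[OF F0] measurable_from_subalg[OF G0])
    show "integrable M (real_cond_exp M F0 U)" "integrable M (real_cond_exp M G0 W)"
      using F0.real_cond_exp_int(1)[OF U(2)] G0.real_cond_exp_int(1)[OF W(2)] by auto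
    show "integrable M (\<lambda>x. (real_cond_exp M F0 U x)\<^sup>2)"
      by (rule integrable_square_real_cond_exp[OF F0M U(2,3)])
    show "integrable M (\<lambda>x. (real_cond_exp M G0 W x)\<^sup>2)"
      by (rule integrable_square_real_cond_exp[OF G0M W(2,3)])
  qed
  finally show ?thesis .
qed

text \<open>A variable of variance zero is almost surely constant, and so is its conditional expectation.\<close>
lemma variance_real_cond_exp_eq_0:
  assumes F: "subalgebra M F" and Z: "integrable M Z" "integrable M (\<lambda>x. (Z x)\<^sup>2)"
    and var0: "variance Z = 0"
  shows "variance (real_cond_exp M F Z) = 0"
proof -
  interpret finite_measure_subalgebra M F by unfold_locales (fact F)
  have [measurable]: "Z \<in> borel_measurable M" using Z by auto
  have "integrable M (\<lambda>x. (Z x - expectation Z)\<^sup>2)"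
    using Z by (simp add: power2_diff)
  then have "AE x in M. (Z x - expectation Z)\<^sup>2 = 0"
    using var0 by (subst (asm) integral_nonneg_eq_0_iff_AE) auto
  then have "AE x in M. Z x = expectation Z" by simp
  then have "AE x in M. real_cond_exp M F Z x = real_cond_exp M F (\<lambda>_. expectation Z) x"
    by (rule real_cond_exp_cong) auto
  moreover have "AE x in M. real_cond_exp M F (\<lambda>_. expectation Z) x = expectation Z"
    by (rule real_cond_exp_F_meas) auto
  ultimately have "AE x in M. real_cond_exp M F Z x = expectation Z"
    by eventually_elim simp
  then have "variance (real_cond_exp M F Z) = variance (\<lambda>_. expectation Z)"
    by (rule variance_cong_AE) auto
  then show ?thesis by (simp add: prob_space)
qed

end

section \<open>Information carried by subvectors of the input\<close>

lemma space_sigma_of_inputs [simp]: "space (sigma_of_inputs M E X u) = space M"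
  by (simp add: sigma_of_inputs_def)

context
  fixes M :: "'a measure" and E :: "nat \<Rightarrow> 'b measure" and X :: "'a \<Rightarrow> nat \<Rightarrow> 'b" and I :: "nat set"
  assumes X: "X \<in> measurable M (PiM I E)"
begin

lemma measurable_restrict_sigma_of_inputs:
  assumes "v \<subseteq> u" "u \<subseteq> I"
  shows "(\<lambda>\<omega>. restrict (X \<omega>) v) \<in> measurable (sigma_of_inputs M E X u) (PiM v E)"
proof -
  have "(\<lambda>\<omega>. restrict (X \<omega>) u) \<in> measurable M (PiM u E)"
    using measurable_compose[OF X measurable_restrict_subset[OF assms(2)]] .
  then have "(\<lambda>\<omega>. restrict (X \<omega>) u) \<in> measurable (sigma_of_inputs M E X u) (PiM u E)"
    unfolding sigma_of_inputs_def by (intro measurable_vimage_algebra1) (auto dest: measurable_space)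
  from measurable_compose[OF this measurable_restrict_subset[OF assms(1)]]
  show ?thesis using assms(1) by (simp add: Int_absorb1 Int_absorb2)
qed

lemma subalgebra_sigma_of_inputs:
  assumes "u \<subseteq> I" shows "subalgebra M (sigma_of_inputs M E X u)"
  unfolding subalgebra_def
proof
  show "sets (sigma_of_inputs M E X u) \<subseteq> sets M"
    using measurable_compose[OF X measurable_restrict_subset[OF assms]]
    unfolding sigma_of_inputs_def by (intro sets_image_in_sets) auto
qed simp

lemma subalgebra_sigma_of_inputs_mono:
  assumes "v \<subseteq> u" "u \<subseteq> I"
  shows "subalgebra (sigma_of_inputs M E X u) (sigma_of_inputs M E X v)"
  unfolding subalgebra_def
proof
  show "sets (sigma_of_inputs M E X v) \<subseteq> sets (sigma_of_inputs M E X u)"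
    using measurable_restrict_sigma_of_inputs[OF assms]
    unfolding sigma_of_inputs_def[of M E X v] by (intro sets_image_in_sets) auto
qed simp

text \<open>
  The intersections on the right generate both parts, hence make every coordinate
  \<open>X\<^sub>l\<close> with \<open>l \<in> u \<union> v\<close> measurable, and so the whole subvector. This is the generating system
  over which independence can be exploited.
\<close>
lemma sets_sigma_of_inputs_Un:
  assumes uv: "u \<subseteq> I" "v \<subseteq> I"
  shows "sets (sigma_of_inputs M E X (u \<union> v)) =
    sigma_sets (space M) {a \<inter> b |a b. a \<in> sets (sigma_of_inputs M E X u) \<and> b \<in> sets (sigma_of_inputs M E X v)}"
    (is "_ = sigma_sets _ ?P")
proof
  let ?F = "sigma_of_inputs M E X"
  have "a \<inter> b \<in> sets (?F (u \<union> v))" if "a \<in> sets (?F u)" "b \<in> sets (?F v)" for a b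
    using subalgebra_sigma_of_inputs_mono[of u "u \<union> v"] subalgebra_sigma_of_inputs_mono[of v "u \<union> v"]
      uv that by (auto simp: subalgebra_def)
  then show "sigma_sets (space M) ?P \<subseteq> sets (?F (u \<union> v))"
    using sets.sigma_sets_subset[of ?P "?F (u \<union> v)"] by auto
next
  let ?F = "sigma_of_inputs M E X"
  let ?N = "sigma (space M) ?P"
  have P: "?P \<subseteq> Pow (space M)"
    using sets.sets_into_space[of _ "?F u"] by auto
  have sets_N: "sets ?N = sigma_sets (space M) ?P" using P by simp
  have sub: "subalgebra ?N (?F u)" "subalgebra ?N (?F v)"
  proof -
    have "a \<in> sets ?N" if a: "a \<in> sets (?F u)" for a
    proof -
      have "a = a \<inter> space M" using sets.sets_into_space[OF a] by auto
      moreover have "space M \<in> sets (?F v)" using sets.top[of "?F v"] by simp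
      ultimately show ?thesis unfolding sets_N using a by (intro sigma_sets.Basic) blast
    qed
    then show "subalgebra ?N (?F u)" using P by (simp add: subalgebra_def subset_iff del: sets_measure_of)
    have "b \<in> sets ?N" if b: "b \<in> sets (?F v)" for b
    proof -
      have "b = space M \<inter> b" using sets.sets_into_space[OF b] by auto
      moreover have "space M \<in> sets (?F u)" using sets.top[of "?F u"] by simp
      ultimately show ?thesis unfolding sets_N using b by (intro sigma_sets.Basic) blast
    qed
    then show "subalgebra ?N (?F v)" using P by (simp add: subalgebra_def subset_iff del: sets_measure_of)
  qed
  have coord: "(\<lambda>\<omega>. X \<omega> l) \<in> measurable ?N (E l)" if l: "l \<in> u \<union> v" for l
  proof -
    have "(\<lambda>\<omega>. X \<omega> l) \<in> measurable (?F w) (E l)" if "l \<in> w" "w \<subseteq> I" for w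
      using measurable_compose[OF measurable_restrict_sigma_of_inputs[OF subset_refl that(2)]
          measurable_component_singleton[OF that(1)]] that(1) by simp
    then show ?thesis using l uv sub by (auto intro: measurable_from_subalg)
  qed
  have meas: "(\<lambda>\<omega>. restrict (X \<omega>) (u \<union> v)) \<in> measurable ?N (PiM (u \<union> v) E)"
    using measurable_restrict[of "u \<union> v" "\<lambda>l \<omega>. X \<omega> l" ?N E] coord by simp
  show "sets (?F (u \<union> v)) \<subseteq> sigma_sets (space M) ?P"
    unfolding sigma_of_inputs_def[of M E X "u \<union> v"] sets_N[symmetric]
    by (rule sets_image_in_sets[OF space_measure_of[OF P] meas])
qed

lemma explained_variance_add_indep:
  assumes M: "prob_space M"
    and C: "C \<subseteq> I" and D: "D \<subseteq> I"
    and indep: "prob_space.indep_set M (sets (sigma_of_inputs M E X C)) (sets (sigma_of_inputs M E X D))"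
    and U: "U \<in> borel_measurable (sigma_of_inputs M E X C)" "integrable M U" "integrable M (\<lambda>x. (U x)\<^sup>2)"
    and W: "W \<in> borel_measurable (sigma_of_inputs M E X D)" "integrable M W" "integrable M (\<lambda>x. (W x)\<^sup>2)"
    and Y: "AE x in M. Y x = U x + W x" "Y \<in> borel_measurable M"
    and u: "u \<subseteq> C" and v: "v \<subseteq> D"
  shows "explained_variance M E X Y (u \<union> v) = explained_variance M E X U u + explained_variance M E X W v"
proof -
  interpret prob_space M by fact
  let ?F = "sigma_of_inputs M E X"
  have uI: "u \<subseteq> I" and vI: "v \<subseteq> I" and uvI: "u \<union> v \<subseteq> I" using u v C D by auto
  interpret H: finite_measure_subalgebra M "?F (u \<union> v)"
    by unfold_locales (fact subalgebra_sigma_of_inputs[OF uvI])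
  have "AE x in M. real_cond_exp M (?F (u \<union> v)) Y x = real_cond_exp M (?F (u \<union> v)) (\<lambda>x. U x + W x) x"
    by (rule H.real_cond_exp_cong) (use Y U W in auto)
  then have "variance (real_cond_exp M (?F (u \<union> v)) Y) =
      variance (real_cond_exp M (?F (u \<union> v)) (\<lambda>x. U x + W x))"
    by (rule variance_cong_AE) auto
  also have "\<dots> = variance (real_cond_exp M (?F u) U) + variance (real_cond_exp M (?F v) W)"
    by (rule variance_real_cond_exp_add_indep[OF
          subalgebra_sigma_of_inputs[OF C] subalgebra_sigma_of_inputs[OF D] indep
          subalgebra_sigma_of_inputs_mono[OF u C] subalgebra_sigma_of_inputs_mono[OF v D]
          subalgebra_sigma_of_inputs[OF uvI] sets_sigma_of_inputs_Un[OF uI vI]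
          subalgebra_sigma_of_inputs_mono[OF Un_upper1 uvI]
          subalgebra_sigma_of_inputs_mono[OF Un_upper2 uvI] U W])
  finally show ?thesis by (simp add: explained_variance_def)
qed

end

section \<open>Marginalising the Shapley weights\<close>

text \<open>
  The value equals \<open>s! (n - 1 - s)! / n!\<close>: the probability that, in a uniformly random ordering of
  \<open>n\<close> inputs, the predecessors of a given input form a given set of size \<open>s\<close>.
\<close>
definition shapley_weight :: "nat \<Rightarrow> nat \<Rightarrow> real" where
  "shapley_weight n s = 1 / real n * inverse (real ((n - 1) choose s))"

text \<open>
  In the ordering interpretation: a further input comes either after or before the
  given one, so it either stays out of the set of predecessors or joins it.
\<close>
lemma shapley_weight_Suc:
  assumes "s < n"
  shows "shapley_weight (Suc n) s + shapley_weight (Suc n) (Suc s) = shapley_weight n s"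
proof -
  obtain m where n: "n = Suc m" using assms by (cases n) auto
  have s: "s \<le> m" using assms n by simp
  define b where "b = real (m choose s)"
  have b: "b > 0" using s by (simp add: b_def zero_less_binomial)
  have "(Suc m - s) * (Suc m choose s) = Suc m * (m choose s)"
    using binomial_absorb_comp[of "Suc m" s] by simp
  then have 1: "(real m + 1 - real s) * real (Suc m choose s) = (real m + 1) * b"
    unfolding b_def using s by (metis (no_types, lifting) Suc_diff_le add.commute of_nat_Suc of_nat_diff of_nat_mult le_SucI)
  have "Suc s * (Suc m choose Suc s) = Suc m * (m choose s)"
    by (rule Suc_times_binomial)
  then have 2: "(real s + 1) * real (Suc m choose Suc s) = (real m + 1) * b"
    unfolding b_def by (metis add.commute of_nat_Suc of_nat_mult)
  have c: "real (Suc (Suc m)) = real m + 2" by simp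
  have pos: "real m + 1 - real s > 0" "real s + 1 > 0" using s by auto
  have e1: "real (Suc m choose s) = (real m + 1) * b / (real m + 1 - real s)"
    using 1 pos by (simp add: field_simps)
  have e2: "real (Suc m choose Suc s) = (real m + 1) * b / (real s + 1)"
    using 2 pos by (simp add: field_simps)
  have "shapley_weight (Suc n) s + shapley_weight (Suc n) (Suc s)
      = 1 / (real m + 2) * ((real m + 1 - real s) / ((real m + 1) * b) + (real s + 1) / ((real m + 1) * b))"
    unfolding shapley_weight_def n diff_Suc_1 e1 e2 inverse_divide c by (simp only: distrib_left)
  also have "\<dots> = 1 / (real m + 2) * ((real m + 2) / ((real m + 1) * b))"
    by (simp add: add_divide_distrib[symmetric])
  also have "\<dots> = shapley_weight n s"
    unfolding shapley_weight_def n diff_Suc_1 b_def[symmetric] by (simp add: field_simps)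
  finally show ?thesis .
qed

text \<open>
  Inserting the elements of \<open>D\<close> one at a time; each insertion splits every weight in two as in
  \<open>shapley_weight_Suc\<close>.
\<close>
lemma sum_shapley_weight_Pow:
  assumes "finite D" "s < n"
  shows "(\<Sum>b\<in>Pow D. shapley_weight (n + card D) (s + card b)) = shapley_weight n s"
  using assms(1)
proof (induction D)
  case empty
  show ?case by simp
next
  case (insert x D)
  have disj: "Pow D \<inter> insert x ` Pow D = {}" using insert by auto
  have inj: "inj_on (insert x) (Pow D)" using insert by (auto simp: inj_on_def)
  have card_ins: "card (insert x b) = Suc (card b)" if "b \<in> Pow D" for b
    by (rule card_insert_disjoint) (use that insert in \<open>auto intro: finite_subset\<close>)
  have lt: "s + card b < n + card D" if "b \<in> Pow D" for b
    using card_mono[of D b] that insert assms(2) by auto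
  have "(\<Sum>b\<in>Pow (insert x D). shapley_weight (n + card (insert x D)) (s + card b)) =
      (\<Sum>b\<in>Pow D. shapley_weight (Suc (n + card D)) (s + card b)) +
      (\<Sum>b\<in>Pow D. shapley_weight (Suc (n + card D)) (Suc (s + card b)))"
    using insert disj card_ins
    by (simp add: Pow_insert sum.union_disjoint sum.reindex[OF inj])
  also have "\<dots> = (\<Sum>b\<in>Pow D. shapley_weight (n + card D) (s + card b))"
    unfolding sum.distrib[symmetric] by (rule sum.cong) (use lt shapley_weight_Suc in auto)
  finally show ?case using insert by simp
qed

text \<open>
  Subsets \<open>u\<close> of \<open>C \<union> D - {i}\<close> correspond to pairs \<open>(u \<inter> C, u \<inter> D)\<close>. Since \<open>\<Delta>\<close> only sees the
  first component, the second one can be summed out of the weight.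
\<close>
lemma shapley_sum_restrict_carrier:
  fixes \<Delta> :: "nat set \<Rightarrow> real"
  assumes fin: "finite C" "finite D" and disj: "C \<inter> D = {}" and i: "i \<in> C"
  shows "(\<Sum>u\<in>Pow (C \<union> D - {i}). shapley_weight (card (C \<union> D)) (card u) * \<Delta> (u \<inter> C)) =
    (\<Sum>a\<in>Pow (C - {i}). shapley_weight (card C) (card a) * \<Delta> a)"
proof -
  let ?w = shapley_weight
  have card_Un: "card (a \<union> b) = card a + card b" if "a \<subseteq> C" "b \<subseteq> D" for a b
    using that fin disj by (intro card_Un_disjoint) (auto intro: finite_subset)
  have "(\<Sum>u\<in>Pow (C \<union> D - {i}). ?w (card (C \<union> D)) (card u) * \<Delta> (u \<inter> C)) =
      (\<Sum>(a, b)\<in>Pow (C - {i}) \<times> Pow D. ?w (card C + card D) (card a + card b) * \<Delta> a)"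
  proof (rule sum.reindex_bij_witness[where j = "\<lambda>u. (u \<inter> C, u \<inter> D)" and i = "\<lambda>(a, b). a \<union> b"])
    fix u assume u: "u \<in> Pow (C \<union> D - {i})"
    then have eq: "u = (u \<inter> C) \<union> (u \<inter> D)" by auto
    then show "(case (u \<inter> C, u \<inter> D) of (a, b) \<Rightarrow> a \<union> b) = u" by simp
    have "card u = card (u \<inter> C) + card (u \<inter> D)"
      using card_Un[of "u \<inter> C" "u \<inter> D"] eq by simp
    then show "(case (u \<inter> C, u \<inter> D) of (a, b) \<Rightarrow> ?w (card C + card D) (card a + card b) * \<Delta> a) =
        ?w (card (C \<union> D)) (card u) * \<Delta> (u \<inter> C)"
      using card_Un[of C D] by simp
    show "(u \<inter> C, u \<inter> D) \<in> Pow (C - {i}) \<times> Pow D" using u by auto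
  next
    fix ab assume "ab \<in> Pow (C - {i}) \<times> Pow D"
    then show "(case ab of (a, b) \<Rightarrow> a \<union> b) \<in> Pow (C \<union> D - {i})"
      and "((case ab of (a, b) \<Rightarrow> a \<union> b) \<inter> C, (case ab of (a, b) \<Rightarrow> a \<union> b) \<inter> D) = ab"
      using disj i by auto
  qed
  also have "\<dots> = (\<Sum>a\<in>Pow (C - {i}). (\<Sum>b\<in>Pow D. ?w (card C + card D) (card a + card b)) * \<Delta> a)"
    by (simp add: sum.cartesian_product[symmetric] sum_distrib_right)
  also have "\<dots> = (\<Sum>a\<in>Pow (C - {i}). ?w (card C) (card a) * \<Delta> a)"
  proof (rule sum.cong[OF refl])
    fix a assume a: "a \<in> Pow (C - {i})"
    then have "a \<subset> C" using i by auto
    then have "card a < card C" using fin(1) by (rule psubset_card_mono[rotated])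
    then show "(\<Sum>b\<in>Pow D. ?w (card C + card D) (card a + card b)) * \<Delta> a = ?w (card C) (card a) * \<Delta> a"
      by (simp add: sum_shapley_weight_Pow[OF fin(2)])
  qed
  finally show ?thesis .
qed

lemma shapley_effect_eq_weighted_sum:
  "shapley_effect M E X D Z i = 1 / prob_space.variance M Z *
    (\<Sum>u\<in>Pow (D - {i}). shapley_weight (card D) (card u) *
      (explained_variance M E X Z (u \<union> {i}) - explained_variance M E X Z u))"
  unfolding shapley_effect_def shapley_weight_def sum_distrib_left
  by (rule sum.cong) (auto simp: field_simps)

section \<open>Shapley effects in a block-additive model\<close>

text \<open>
  The two-group form of the result. The increments of \<open>Y\<close> at \<open>i\<close> are those of \<open>U\<close>, because the
  contribution of \<open>W\<close> cancels; the Shapley sum over \<open>C \<union> D\<close> then collapses to the one over \<open>C\<close>.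
\<close>
lemma shapley_effect_add_indep:
  assumes M: "prob_space M" and X: "X \<in> measurable M (PiM (C \<union> D) E)"
    and fin: "finite C" "finite D" and disj: "C \<inter> D = {}" and i: "i \<in> C"
    and indep: "prob_space.indep_set M (sets (sigma_of_inputs M E X C)) (sets (sigma_of_inputs M E X D))"
    and U: "U \<in> borel_measurable (sigma_of_inputs M E X C)" "integrable M U" "integrable M (\<lambda>x. (U x)\<^sup>2)"
    and W: "W \<in> borel_measurable (sigma_of_inputs M E X D)" "integrable M W" "integrable M (\<lambda>x. (W x)\<^sup>2)"
    and Y: "AE x in M. Y x = U x + W x" "Y \<in> borel_measurable M"
  shows "shapley_effect M E X (C \<union> D) Y i =
    prob_space.variance M U / prob_space.variance M Y * shapley_effect M E X C U i"
proof -
  interpret prob_space M by fact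
  let ?V = "explained_variance M E X"
  let ?\<Delta> = "\<lambda>a. ?V U (a \<union> {i}) - ?V U a"
  have V: "?V Y (a \<union> b) = ?V U a + ?V W b" if "a \<subseteq> C" "b \<subseteq> D" for a b
    by (rule explained_variance_add_indep[OF X M _ _ indep U W Y that]) auto
  have increment: "?V Y (u \<union> {i}) - ?V Y u = ?\<Delta> (u \<inter> C)" if "u \<subseteq> C \<union> D - {i}" for u
  proof -
    have "u = (u \<inter> C) \<union> (u \<inter> D)" "u \<union> {i} = (u \<inter> C \<union> {i}) \<union> (u \<inter> D)" using that by auto
    then show ?thesis
      using V[of "u \<inter> C" "u \<inter> D"] V[of "u \<inter> C \<union> {i}" "u \<inter> D"] i by simp
  qed
  let ?S = "\<Sum>a\<in>Pow (C - {i}). shapley_weight (card C) (card a) * ?\<Delta> a"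
  have "shapley_effect M E X (C \<union> D) Y i = 1 / variance Y *
      (\<Sum>u\<in>Pow (C \<union> D - {i}). shapley_weight (card (C \<union> D)) (card u) * ?\<Delta> (u \<inter> C))"
    unfolding shapley_effect_eq_weighted_sum
    by (intro arg_cong[where f = "(*) _"] sum.cong) (use increment in auto)
  also have "\<dots> = 1 / variance Y * ?S"
    using shapley_sum_restrict_carrier[OF fin disj i, of ?\<Delta>] by simp
  also have "\<dots> = variance U / variance Y * shapley_effect M E X C U i"
  proof (cases "variance U = 0")
    case True
    have V0: "?V U a = 0" if "a \<subseteq> C" for a
      unfolding explained_variance_def
      by (rule variance_real_cond_exp_eq_0[OF subalgebra_sigma_of_inputs[OF X] U(2,3) True])
        (use that in auto)
    have "?S = 0"
    proof (rule sum.neutral, rule ballI)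
      fix a assume "a \<in> Pow (C - {i})"
      then have "a \<subseteq> C" "a \<union> {i} \<subseteq> C" using i by auto
      then show "shapley_weight (card C) (card a) * ?\<Delta> a = 0"
        by (simp only: V0) simp
    qed
    then show ?thesis using True by simp
  next
    case False
    then show ?thesis unfolding shapley_effect_eq_weighted_sum by simp
  qed
  finally show ?thesis .
qed

text \<open>
  Independence of the blocks gives independence of one block from the tuple of all
  the others. That tuple determines \<open>X\<^sub>l\<close> for every \<open>l\<close> in the union of those blocks: read
  coordinate \<open>l\<close> off any block that contains it.
\<close>
lemma (in prob_space) indep_set_sigma_of_inputs_block:
  fixes E :: "nat \<Rightarrow> 'b measure"
  assumes X: "X \<in> measurable M (PiM I E)"
    and indep: "indep_vars (\<lambda>j. PiM (C j) E) (\<lambda>j \<omega>. restrict (X \<omega>) (C j)) J"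
    and j: "j \<in> J" and disj: "disjoint_family_on C J"
  shows "indep_set (sets (sigma_of_inputs M E X (C j)))
    (sets (sigma_of_inputs M E X (\<Union>l\<in>J - {j}. C l)))"
proof -
  let ?R = "\<lambda>K \<omega>. \<lambda>l\<in>K. restrict (X \<omega>) (C l)"
  let ?D = "\<Union>l\<in>J - {j}. C l"
  obtain blk where blk: "blk m \<in> J - {j} \<and> m \<in> C (blk m)" if "m \<in> ?D" for m
  proof -
    have "\<forall>m\<in>?D. \<exists>l. l \<in> J - {j} \<and> m \<in> C l" by auto
    then show ?thesis using that by metis
  qed
  have ind: "indep_var (PiM {j} (\<lambda>l. PiM (C l) E)) (?R {j}) (PiM (J - {j}) (\<lambda>l. PiM (C l) E)) (?R (J - {j}))"
    using j by (intro indep_var_restrict[OF indep]) auto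
  have m1: "(\<lambda>v. v j) \<in> measurable (PiM {j} (\<lambda>l. PiM (C l) E)) (PiM (C j) E)" by simp
  have m2: "(\<lambda>v. \<lambda>m\<in>?D. v (blk m) m) \<in> measurable (PiM (J - {j}) (\<lambda>l. PiM (C l) E)) (PiM ?D E)"
  proof (rule measurable_restrict)
    fix m assume "m \<in> ?D"
    then have b: "blk m \<in> J - {j}" "m \<in> C (blk m)" using blk by auto
    have "(\<lambda>v. v (blk m)) \<in> measurable (PiM (J - {j}) (\<lambda>l. PiM (C l) E)) (PiM (C (blk m)) E)"
      by (rule measurable_component_singleton[OF b(1)])
    from measurable_compose[OF this measurable_component_singleton[OF b(2)]]
    show "(\<lambda>v. v (blk m) m) \<in> measurable (PiM (J - {j}) (\<lambda>l. PiM (C l) E)) (E m)" .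
  qed
  have e1: "(\<lambda>v. v j) \<circ> ?R {j} = (\<lambda>\<omega>. restrict (X \<omega>) (C j))" by (auto simp: fun_eq_iff)
  have e2: "(\<lambda>v. \<lambda>m\<in>?D. v (blk m) m) \<circ> ?R (J - {j}) = (\<lambda>\<omega>. restrict (X \<omega>) ?D)"
    using blk by (intro ext) (auto simp: restrict_def fun_eq_iff)
  show ?thesis
    using indep_var_compose[OF ind m1 m2]
    unfolding e1 e2 indep_var_eq sigma_of_inputs_def sets_vimage_algebra by blast
qed

theorem corollary2:
  fixes M :: "'a measure"
    and E :: "nat \<Rightarrow> 'b measure"
    and X :: "'a \<Rightarrow> nat \<Rightarrow> 'b"
    and f :: "(nat \<Rightarrow> 'b) \<Rightarrow> real"
    and g :: "nat \<Rightarrow> (nat \<Rightarrow> 'b) \<Rightarrow> real"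
    and C :: "nat \<Rightarrow> nat set"
    and block :: "nat \<Rightarrow> nat"
    and p k :: nat
  defines "Y \<equiv> \<lambda>\<omega>. f (X \<omega>)"
    and "A \<equiv> \<lambda>j \<omega>. restrict (X \<omega>) (C j)"
  assumes "prob_space M"
    and "X \<in> measurable M (PiM {1..p} E)"
    and "f \<in> borel_measurable (PiM {1..p} E)"
    and "integrable M (\<lambda>\<omega>. (Y \<omega>)\<^sup>2)"
    and "prob_space.variance M Y \<noteq> 0"
    and "\<And>j. j \<in> {1..k} \<Longrightarrow> C j \<noteq> {}"
    and "disjoint_family_on C {1..k}"
    and "(\<Union>j\<in>{1..k}. C j) = {1..p}"
    and "prob_space.indep_vars M (\<lambda>j. PiM (C j) E) A {1..k}"
    and "\<And>j. j \<in> {1..k} \<Longrightarrow> g j \<in> borel_measurable (PiM (C j) E)"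
    and "\<And>j. j \<in> {1..k} \<Longrightarrow> integrable M (\<lambda>\<omega>. (g j (A j \<omega>))\<^sup>2)"
    and "AE \<omega> in M. Y \<omega> = (\<Sum>j\<in>{1..k}. g j (A j \<omega>))"
    and "\<And>i. i \<in> {1..p} \<Longrightarrow> block i \<in> {1..k} \<and> i \<in> C (block i)"
  shows "\<forall>i\<in>{1..p}.
    shapley_effect M E X {1..p} Y i =
      prob_space.variance M (\<lambda>\<omega>. g (block i) (A (block i) \<omega>)) / prob_space.variance M Y *
      shapley_effect M E X (C (block i)) (\<lambda>\<omega>. g (block i) (A (block i) \<omega>)) i"
proof
  fix i assume "i \<in> {1..p}"
  interpret prob_space M by fact
  note X = assms(4) and f = assms(5) and disj = assms(9) and cover = assms(10)
    and indep = assms(11) and g = assms(12) and g2 = assms(13) and Y_sum = assms(14)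
  define j where "j = block i"
  have j: "j \<in> {1..k}" and i: "i \<in> C j" using assms(15) \<open>i \<in> {1..p}\<close> by (auto simp: j_def)
  define D where "D = (\<Union>l\<in>{1..k} - {j}. C l)"
  have CD: "C j \<union> D = {1..p}" using j cover by (auto simp: D_def)
  have "C j \<inter> C l = {}" if "l \<in> {1..k} - {j}" for l
    using disjoint_family_onD[OF disj j, of l] that by auto
  then have CjD: "C j \<inter> D = {}" unfolding D_def by blast
  have "finite (C j \<union> D)" unfolding CD by simp
  then have fin: "finite (C j)" "finite D" by auto
  let ?g = "\<lambda>l \<omega>. g l (A l \<omega>)"
  let ?W = "\<lambda>\<omega>. \<Sum>l\<in>{1..k} - {j}. ?g l \<omega>"
  have A_meas: "A l \<in> measurable (sigma_of_inputs M E X u) (PiM (C l) E)"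
    if "C l \<subseteq> u" "u \<subseteq> {1..p}" for l u
    unfolding A_def by (rule measurable_restrict_sigma_of_inputs[OF X that])
  have g_meas: "?g l \<in> borel_measurable (sigma_of_inputs M E X u)"
    if "l \<in> {1..k}" "C l \<subseteq> u" "u \<subseteq> {1..p}" for l u
    using measurable_compose[OF A_meas[OF that(2,3)] g[OF that(1)]] .
  have g_M: "?g l \<in> borel_measurable M" if "l \<in> {1..k}" for l
  proof -
    have "C l \<subseteq> {1..p}" using that unfolding cover[symmetric] by blast
    then show ?thesis
      by (rule measurable_from_subalg[OF subalgebra_sigma_of_inputs[OF X subset_refl] g_meas[OF that _ subset_refl]])
  qed
  have g_int: "integrable M (?g l)" if "l \<in> {1..k}" for l
    using square_integrable_imp_integrable[OF g_M g2] that by auto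
  have Y_M: "Y \<in> borel_measurable M"
    unfolding Y_def by (rule measurable_compose[OF X f])
  have W: "?W \<in> borel_measurable (sigma_of_inputs M E X D)" "integrable M ?W"
    using g_int CD by (auto intro!: borel_measurable_sum g_meas simp: D_def)
  have Y_split: "AE \<omega> in M. Y \<omega> = ?g j \<omega> + ?W \<omega>"
    using Y_sum by eventually_elim (use j in \<open>simp add: sum.remove[of _ j]\<close>)
  (* Almost surely W is Y minus the summand of block j, a difference of square-integrable variables. *)
  have W2: "integrable M (\<lambda>\<omega>. (?W \<omega>)\<^sup>2)"
  proof (rule Bochner_Integration.integrable_bound)
    show "integrable M (\<lambda>\<omega>. 2 * (Y \<omega>)\<^sup>2 + 2 * (?g j \<omega>)\<^sup>2)"
      using assms(6) g2[OF j] by auto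
    show "(\<lambda>\<omega>. (?W \<omega>)\<^sup>2) \<in> borel_measurable M"
      using g_M by auto
    show "AE \<omega> in M. norm ((?W \<omega>)\<^sup>2) \<le> norm (2 * (Y \<omega>)\<^sup>2 + 2 * (?g j \<omega>)\<^sup>2)"
      using Y_split
    proof eventually_elim
      case (elim \<omega>)
      have "(y - u)\<^sup>2 \<le> 2 * y\<^sup>2 + 2 * u\<^sup>2" for y u :: real
        using zero_le_power2[of "y + u"] by (simp add: power2_sum power2_diff)
      moreover have "?W \<omega> = Y \<omega> - ?g j \<omega>" using elim by simp
      ultimately show ?case by simp
    qed
  qed
  have "indep_set (sets (sigma_of_inputs M E X (C j))) (sets (sigma_of_inputs M E X D))"
    unfolding D_def by (rule indep_set_sigma_of_inputs_block[OF X indep[unfolded A_def] j disj])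
  from shapley_effect_add_indep[OF \<open>prob_space M\<close> X[folded CD] fin CjD i this
      g_meas[OF j subset_refl] g_int[OF j] g2[OF j] W W2 Y_split Y_M] CD
  show "shapley_effect M E X {1..p} Y i =
      variance (?g (block i)) / variance Y * shapley_effect M E X (C (block i)) (?g (block i)) i"
    by (auto simp: j_def)
qed

end
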